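(* Let $X$ be an inertial observer (a timelike straight line) in Minkowski spacetime $\mathcal M$, and let $\tilde T$ be a clock on $X$ up to an additive constant. Let $R$ be an equivalence relation on $\mathcal M$ which is (implicitly) $(X,\kappa,\tilde T)$-definable, and such that for every $y\in\mathcal M$ there exists a unique $x\in X$ with $xRy$. Then there exists a function $f:[0;+\infty[\,\to\mathbb R$ with $f(0)=0$ such that $R=\Gamma_{X,\tilde f}$.
   Context: Minkowski spacetime is $\mathcal M=(\mathbb R^4,\eta,Or)$, where $\eta$ is the Minkowski metric of signature $(+,-,-,-)$ and $Or$ is a time orientation. An inertial observer is a timelike straight line $X\subset\mathcal M$. Causal connectibility is the relation $p\,\kappa\, q\Leftrightarrow\eta(p-q,p-q)\ge 0$. A clock on $X$ is a continuous function $T:X\to\mathbb R$ such that $(T(x)-T(x'))^2=\eta(x-x',x-x')$ for all $x,x'\in X$. $\tilde T$ denotes the class of $T$ modulo additive constants. The time orientation is the one for which $T$ is increasing towards the future along $X$. An $(X,\kappa,\tilde T)$-automorphism is a bijection $g:\mathbb R^4\to\mathbb R^4$ such that $g(X)=X$, such that $p\,\kappa\, q\Leftrightarrow g(p)\,\kappa\, g(q)$ for all $p,q$, and such that $T\circ g|_X-T$ is constant on $X$. (Equivalently, $g$ preserves $X$, $\eta$ and the time orientation.) A relation $R$ is implicitly $(X,\kappa,\tilde T)$-definable if $pRq\Rightarrow g(p)Rg(q)$ for every $(X,\kappa,\tilde T)$-automorphism $g$ and all events $p,q$. Choose inertial coordinates $(t,\vec u)\in\mathbb R\times\mathbb R^3$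 on $\mathcal M$ (in units with $c=1$) adapted to $X$, that is, such that $X$ is the time axis $\{\vec u=\vec 0\}$, with $t|_X\in\tilde T$. For a function $h:[0;+\infty[\,\to\mathbb R$ (not necessarily continuous), let $\Gamma_{X,h}$ be the set of events with coordinates $(t,\vec u)$ such that $t=h(\|\vec u\|)$. For $f:[0;+\infty[\,\to\mathbb R$ with $f(0)=0$, the relation $\Gamma_{X,\tilde f}$ is defined by $p\,\Gamma_{X,\tilde f}\,q\Leftrightarrow\exists\tau\in\mathbb R,\ p\in\Gamma_{X,f+\tau}$ and $q\in\Gamma_{X,f+\tau}$; it does not depend on the choice of such adapted coordinates. *)

theory Defs
  imports "HOL-Analysis.Analysis"
begin

type_synonym event = "real^4"

definition eta :: "event \<Rightarrow> event \<Rightarrow> real" where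
  "eta v w = v$1 * w$1 - v$2 * w$2 - v$3 * w$3 - v$4 * w$4"

definition causal :: "event \<Rightarrow> event \<Rightarrow> bool" where
  "causal p q \<longleftrightarrow> eta (p - q) (p - q) \<ge> 0"

definition inertial_observer :: "event set \<Rightarrow> bool" where
  "inertial_observer X \<longleftrightarrow> (\<exists>x0 v. eta v v > 0 \<and> X = range (\<lambda>s. x0 + s *\<^sub>R v))"

text \<open>
  Only the values of a clock on \<open>X\<close> matter. The time orientation of spacetime is not a separate
  datum: it is the one for which the clock increases towards the future.
\<close>

definition clock :: "event set \<Rightarrow> (event \<Rightarrow> real) \<Rightarrow> bool" where
  "clock X T \<longleftrightarrow> continuous_on X T \<and>
     (\<forall>x\<in>X. \<forall>y\<in>X. (T x - T y)\<^sup>2 = eta (x - y) (x - y))"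

definition clock_class :: "event set \<Rightarrow> (event \<Rightarrow> real) \<Rightarrow> (event \<Rightarrow> real) set" where
  "clock_class X T = {T'. \<exists>c. \<forall>x\<in>X. T' x = T x + c}"

definition automorphism :: "event set \<Rightarrow> (event \<Rightarrow> real) \<Rightarrow> (event \<Rightarrow> event) \<Rightarrow> bool" where
  "automorphism X T g \<longleftrightarrow> bij g \<and> g ` X = X \<and>
     (\<forall>p q. causal p q \<longleftrightarrow> causal (g p) (g q)) \<and>
     (\<exists>c. \<forall>x\<in>X. T (g x) - T x = c)"

definition implicitly_definable ::
    "event set \<Rightarrow> (event \<Rightarrow> real) \<Rightarrow> (event \<Rightarrow> event \<Rightarrow> bool) \<Rightarrow> bool" where
  "implicitly_definable X T R \<longleftrightarrow>
     (\<forall>g. automorphism X T g \<longrightarrow> (\<forall>p q. R p q \<longrightarrow> R (g p) (g q)))"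

text \<open>
  Coordinates \<open>(t, u)\<close>: an affine bijection whose linear part carries the metric to
  \<open>t t' - u \<bullet> u'\<close>.
\<close>

definition inertial_coordinates :: "(event \<Rightarrow> real \<times> (real^3)) \<Rightarrow> bool" where
  "inertial_coordinates \<phi> \<longleftrightarrow> (\<exists>L p0. linear L \<and> bij L \<and>
     (\<forall>v w. eta v w = fst (L v) * fst (L w) - snd (L v) \<bullet> snd (L w)) \<and>
     \<phi> = (\<lambda>p. L (p - p0)))"

definition adapted_coordinates ::
    "event set \<Rightarrow> (event \<Rightarrow> real) \<Rightarrow> (event \<Rightarrow> real \<times> (real^3)) \<Rightarrow> bool" where
  "adapted_coordinates X T \<phi> \<longleftrightarrow> inertial_coordinates \<phi> \<and>
     X = {p. snd (\<phi> p) = 0} \<and> (\<lambda>p. fst (\<phi> p)) \<in> clock_class X T"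

text \<open>The function \<open>h\<close> is only ever evaluated on \<open>[0, \<infinity>)\<close>.\<close>

definition Gamma :: "(event \<Rightarrow> real \<times> (real^3)) \<Rightarrow> (real \<Rightarrow> real) \<Rightarrow> event set" where
  "Gamma \<phi> h = {p. fst (\<phi> p) = h (norm (snd (\<phi> p)))}"

text \<open>
  The choice of adapted coordinates in the next definition is immaterial, and one always exists:
  see \<open>Gamma_rel_iff\<close> and \<open>adapted_coordinates_exist\<close> below.
\<close>

definition Gamma_rel ::
    "event set \<Rightarrow> (event \<Rightarrow> real) \<Rightarrow> (real \<Rightarrow> real) \<Rightarrow> event \<Rightarrow> event \<Rightarrow> bool" where
  "Gamma_rel X T f p q \<longleftrightarrow> (\<exists>\<phi>. adapted_coordinates X T \<phi> \<and>
     (\<exists>\<tau>. p \<in> Gamma \<phi> (\<lambda>r. f r + \<tau>) \<and> q \<in> Gamma \<phi> (\<lambda>r. f r + \<tau>)))"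

lemma adapted_coordinates_unique:
  assumes "adapted_coordinates X T \<phi>" "adapted_coordinates X T \<psi>"
  shows "\<exists>c. \<forall>p. fst (\<psi> p) = fst (\<phi> p) + c \<and> norm (snd (\<psi> p)) = norm (snd (\<phi> p))"
proof -
  obtain L a where L: "linear L" "bij L"
      "\<And>v w. eta v w = fst (L v) * fst (L w) - snd (L v) \<bullet> snd (L w)" "\<phi> = (\<lambda>p. L (p - a))"
    using assms(1) unfolding adapted_coordinates_def inertial_coordinates_def by blast
  obtain M b where M: "linear M" "bij M"
      "\<And>v w. eta v w = fst (M v) * fst (M w) - snd (M v) \<bullet> snd (M w)" "\<psi> = (\<lambda>p. M (p - b))"
    using assms(2) unfolding adapted_coordinates_def inertial_coordinates_def by blast
  have X: "X = {p. snd (\<phi> p) = 0}" "X = {p. snd (\<psi> p) = 0}"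
    using assms unfolding adapted_coordinates_def by auto
  have "\<exists>c. \<forall>x\<in>X. fst (\<phi> x) = T x + c" "\<exists>c. \<forall>x\<in>X. fst (\<psi> x) = T x + c"
    using assms unfolding adapted_coordinates_def clock_class_def by blast+
  then obtain c1 c2 where "\<And>x. x \<in> X \<Longrightarrow> fst (\<phi> x) = T x + c1" "\<And>x. x \<in> X \<Longrightarrow> fst (\<psi> x) = T x + c2"
    by blast
  then have c: "fst (\<psi> x) = fst (\<phi> x) + (c2 - c1)" if "x \<in> X" for x
    using that by simp
  have e1: "eta (p - x) (p - x) = (fst (\<phi> p) - fst (\<phi> x))\<^sup>2 - (norm (snd (\<phi> p)))\<^sup>2"
    if "x \<in> X" for p x
  proof -
    have "L (p - x) = \<phi> p - \<phi> x"
      unfolding L(4) by (simp flip: linear_diff[OF L(1)])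
    moreover have "snd (\<phi> x) = 0" using that X by auto
    ultimately show ?thesis
      by (simp add: L(3) power2_eq_square power2_norm_eq_inner[unfolded power2_eq_square])
  qed
  have e2: "eta (p - x) (p - x) = (fst (\<psi> p) - fst (\<psi> x))\<^sup>2 - (norm (snd (\<psi> p)))\<^sup>2"
    if "x \<in> X" for p x
  proof -
    have "M (p - x) = \<psi> p - \<psi> x"
      unfolding M(4) by (simp flip: linear_diff[OF M(1)])
    moreover have "snd (\<psi> x) = 0" using that X by auto
    ultimately show ?thesis
      by (simp add: M(3) power2_eq_square power2_norm_eq_inner[unfolded power2_eq_square])
  qed
  have "fst (\<psi> p) = fst (\<phi> p) + (c2 - c1) \<and> norm (snd (\<psi> p)) = norm (snd (\<phi> p))" for p
  proof -
    have on_X: "\<exists>x\<in>X. fst (\<phi> x) = s" for s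
    proof -
      obtain d where "L d = (s, 0)" using L(2) by (metis bij_pointE)
      then have "\<phi> (a + d) = (s, 0)" by (simp add: L(4))
      then show ?thesis unfolding X(1) by (intro bexI[of _ "a + d"]) simp_all
    qed
    have k: "(fst (\<phi> p) - s)\<^sup>2 - (norm (snd (\<phi> p)))\<^sup>2 =
      (fst (\<psi> p) - (s + (c2 - c1)))\<^sup>2 - (norm (snd (\<psi> p)))\<^sup>2" for s
      using on_X[of s] e1 e2 c by metis
    have "fst (\<psi> p) = fst (\<phi> p) + (c2 - c1)"
      using k[of 0] k[of 1] by (simp add: power2_eq_square algebra_simps)
    moreover from this have "(norm (snd (\<psi> p)))\<^sup>2 = (norm (snd (\<phi> p)))\<^sup>2"
      using k[of 0] by simp
    ultimately show ?thesis by simp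
  qed
  then show ?thesis by blast
qed

lemma Gamma_rel_iff:
  assumes "adapted_coordinates X T \<phi>"
  shows "Gamma_rel X T f p q \<longleftrightarrow>
    (\<exists>\<tau>. p \<in> Gamma \<phi> (\<lambda>r. f r + \<tau>) \<and> q \<in> Gamma \<phi> (\<lambda>r. f r + \<tau>))"
proof
  assume "Gamma_rel X T f p q"
  then obtain \<psi> \<tau> where \<psi>: "adapted_coordinates X T \<psi>"
      and \<tau>: "p \<in> Gamma \<psi> (\<lambda>r. f r + \<tau>)" "q \<in> Gamma \<psi> (\<lambda>r. f r + \<tau>)"
    unfolding Gamma_rel_def by blast
  obtain c where "\<And>p. fst (\<phi> p) = fst (\<psi> p) + c \<and> norm (snd (\<phi> p)) = norm (snd (\<psi> p))"
    using adapted_coordinates_unique[OF \<psi> assms] by blast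
  then have "p \<in> Gamma \<phi> (\<lambda>r. f r + (\<tau> + c)) \<and> q \<in> Gamma \<phi> (\<lambda>r. f r + (\<tau> + c))"
    using \<tau> by (simp add: Gamma_def)
  then show "\<exists>\<tau>. p \<in> Gamma \<phi> (\<lambda>r. f r + \<tau>) \<and> q \<in> Gamma \<phi> (\<lambda>r. f r + \<tau>)" by blast
qed (use assms in \<open>auto simp: Gamma_rel_def\<close>)

lemma lorentz_frame:
  assumes v: "eta v v = 1"
  shows "\<exists>L :: event \<Rightarrow> real \<times> (real^3). linear L \<and> bij L \<and>
    (\<forall>v w. eta v w = fst (L v) * fst (L w) - snd (L v) \<bullet> snd (L w)) \<and> L v = (1, 0)"
proof -
  define C :: "event \<Rightarrow> real \<times> (real^3)" where "C = (\<lambda>p. (p$1, vector [p$2, p$3, p$4]))"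
  define D :: "real \<times> (real^3) \<Rightarrow> event"
    where "D = (\<lambda>x. vector [fst x, snd x $ 1, snd x $ 2, snd x $ 3])"
  have v4: "(vector [a, b, c, d] :: real^4) $ 1 = a" "(vector [a, b, c, d] :: real^4) $ 2 = b"
    "(vector [a, b, c, d] :: real^4) $ 3 = c" "(vector [a, b, c, d] :: real^4) $ 4 = d"
    for a b c d :: real
    by (simp_all add: vector_def)
  have linC: "linear C"
    by (rule linearI) (simp_all add: C_def vec_eq_iff forall_3)
  have "C (D x) = x" for x
    by (cases x) (simp add: C_def D_def v4 vec_eq_iff forall_3)
  moreover have "D (C p) = p" for p
    by (simp add: C_def D_def v4 vec_eq_iff forall_4)
  ultimately have bijC: "bij C"
    by (intro bijI') metis+
  have isoC: "eta v w = fst (C v) * fst (C w) - snd (C v) \<bullet> snd (C w)" for v w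
    by (simp add: C_def eta_def inner_vec_def sum_3)
  have comm: "eta x y = eta y x" for x y by (simp add: eta_def mult.commute)
  have lin1: "eta (x + y) z = eta x z + eta y z" "eta (x - y) z = eta x z - eta y z"
      "eta (a *\<^sub>R x) z = a * eta x z" for x y z a
    by (simp_all add: eta_def algebra_simps)
  have lin2: "eta z (x + y) = eta z x + eta z y" "eta z (x - y) = eta z x - eta z y"
      "eta z (a *\<^sub>R x) = a * eta z x" for x y z a
    by (simp_all add: eta_def algebra_simps)
  define e :: event where "e = vector [1, 0, 0, 0]"
  have Ce: "C e = (1, 0)" by (simp add: C_def e_def v4 vec_eq_iff forall_3)
  have ee: "eta e e = 1" "eta v e = v$1" by (simp_all add: eta_def e_def v4)
  show ?thesis
  proof (cases "v = e")
    case True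
    then show ?thesis using linC bijC isoC Ce by blast
  next
    case False
    define w where "w = v - e"
    have ww: "eta w w = 2 - 2 * v$1" "eta v w = 1 - v$1"
      using v by (simp_all add: w_def lin1 lin2 ee comm[of e v])
    have "v$1 \<noteq> 1"
    proof
      assume 1: "v$1 = 1"
      then have "v$2 * v$2 + v$3 * v$3 + v$4 * v$4 = 0"
        using v by (simp add: eta_def)
      then have "v$2 = 0 \<and> v$3 = 0 \<and> v$4 = 0"
        by (smt (verit) mult_eq_0_iff zero_le_square)
      with 1 have "v = e" by (simp add: e_def vec_eq_iff forall_4 v4)
      with False show False by simp
    qed
    then have w0: "eta w w \<noteq> 0" using ww by simp
    define S where "S = (\<lambda>x. x - (2 * eta x w / eta w w) *\<^sub>R w)"
    have linS: "linear S"
      by (rule linearI) (simp_all add: S_def lin1 algebra_simps add_divide_distrib)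
    have Sw: "eta (S x) w = - eta x w" for x
      using w0 by (simp add: S_def lin1)
    have SS: "S (S x) = x" for x
      using Sw[of x] by (simp add: S_def)
    have bijS: "bij S" by (intro bijI') (metis SS)+
    have isoS: "eta (S x) (S y) = eta x y" for x y
    proof -
      define b where "b = 2 * eta y w / eta w w"
      have "eta (S x) (S y) = eta (S x) y - b * eta (S x) w"
        by (simp only: S_def[THEN fun_cong, of y] b_def lin2)
      also have "\<dots> = eta x y - (2 * eta x w / eta w w) * eta w y + b * eta x w"
        unfolding Sw unfolding S_def lin1 by simp
      also have "(2 * eta x w / eta w w) * eta w y = b * eta x w"
        unfolding b_def comm[of w y] by simp
      finally show ?thesis by simp
    qed
    have Sv: "S v = e"
    proof -
      have "2 * eta v w / eta w w = 1" using w0 ww by simp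
      then show ?thesis unfolding S_def by (simp add: w_def)
    qed
    have "linear (C \<circ> S)" "bij (C \<circ> S)"
      using linear_compose[OF linS linC] bij_comp[OF bijS bijC] by auto
    moreover have "eta x y = fst ((C \<circ> S) x) * fst ((C \<circ> S) y) - snd ((C \<circ> S) x) \<bullet> snd ((C \<circ> S) y)"
      for x y
      using isoS[of x y] isoC[of "S x" "S y"] by simp
    moreover have "(C \<circ> S) v = (1, 0)" using Sv Ce by simp
    ultimately show ?thesis by blast
  qed
qed

lemma adapted_coordinates_exist:
  assumes "inertial_observer X" "clock X T"
  shows "\<exists>\<phi>. adapted_coordinates X T \<phi>"
proof -
  obtain a u where u: "eta u u > 0" and Xu: "X = range (\<lambda>s. a + s *\<^sub>R u)"
    using assms(1) unfolding inertial_observer_def by blast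
  have eta_scale: "eta (c *\<^sub>R x) (c *\<^sub>R x) = c\<^sup>2 * eta x x" for c x
    by (simp add: eta_def power2_eq_square algebra_simps)
  define v where "v = (1 / sqrt (eta u u)) *\<^sub>R u"
  have v1: "eta v v = 1"
    using u by (simp add: v_def eta_scale power_divide)
  have uv: "u = sqrt (eta u u) *\<^sub>R v" using u by (simp add: v_def)
  have onX: "a + s *\<^sub>R v \<in> X" for s
    unfolding Xu v_def by auto
  have Xv: "\<exists>s. x = a + s *\<^sub>R v" if "x \<in> X" for x
    using that unfolding Xu by (subst (asm) uv) auto
  define h where "h = (\<lambda>s. T (a + s *\<^sub>R v) - T a)"
  have "(h s - h s')\<^sup>2 = (s - s')\<^sup>2" for s s'
  proof -
    have "(h s - h s')\<^sup>2 = eta ((s - s') *\<^sub>R v) ((s - s') *\<^sub>R v)"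
      using assms(2) onX[of s] onX[of s'] unfolding clock_def h_def
      by (simp add: scaleR_left_diff_distrib)
    then show ?thesis by (simp add: eta_scale v1)
  qed
  note hh = this
  have h0: "h 0 = 0" by (simp add: h_def)
  have hsq: "(h s)\<^sup>2 = s\<^sup>2" for s using hh[of s 0] h0 by simp
  have prod: "h s * h 1 = s" for s
    using hh[of s 1] hsq[of s] hsq[of 1] by (simp add: power2_diff)
  define \<sigma> where "\<sigma> = h 1"
  have \<sigma>: "\<sigma> * \<sigma> = 1" using prod[of 1] by (simp add: \<sigma>_def)
  have hs: "h s = \<sigma> * s" for s
    using prod[of s] \<sigma> by (metis \<sigma>_def mult.assoc mult.commute mult.right_neutral)
  define w where "w = \<sigma> *\<^sub>R v"
  have "eta w w = 1" using v1 \<sigma> by (simp add: w_def eta_scale power2_eq_square)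
  then obtain L :: "event \<Rightarrow> real \<times> (real^3)" where L: "linear L" "bij L"
      "\<forall>v w. eta v w = fst (L v) * fst (L w) - snd (L v) \<bullet> snd (L w)" "L w = (1, 0)"
    using lorentz_frame by blast
  have Lw: "L (s *\<^sub>R w) = (s, 0)" for s
    using L(1,4) by (simp add: linear_scale)
  have vw: "s *\<^sub>R v = (\<sigma> * s) *\<^sub>R w" for s
    using \<sigma> by (simp add: w_def mult.commute mult.left_commute)
  define \<phi> where "\<phi> = (\<lambda>p. L (p - a))"
  have \<phi>X: "\<phi> (a + s *\<^sub>R v) = (\<sigma> * s, 0)" for s
    by (simp add: \<phi>_def vw Lw)
  have "inertial_coordinates \<phi>"
    unfolding inertial_coordinates_def using L(1-3) \<phi>_def by blast
  moreover have "X = {p. snd (\<phi> p) = 0}"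
  proof (intro set_eqI iffI)
    fix p assume "p \<in> X"
    then show "p \<in> {p. snd (\<phi> p) = 0}" using Xv \<phi>X by fastforce
  next
    fix p assume "p \<in> {p. snd (\<phi> p) = 0}"
    then have "L (p - a) = L (fst (\<phi> p) *\<^sub>R w)"
      by (simp add: Lw prod_eq_iff \<phi>_def)
    then have "p - a = fst (\<phi> p) *\<^sub>R w" using L(2) by (metis bij_pointE)
    then have "p = a + (fst (\<phi> p) * \<sigma>) *\<^sub>R v" by (simp add: w_def algebra_simps)
    then show "p \<in> X" using onX by metis
  qed
  moreover have "(\<lambda>p. fst (\<phi> p)) \<in> clock_class X T"
  proof -
    have "fst (\<phi> x) = T x + (- T a)" if "x \<in> X" for x
    proof -
      obtain s where s: "x = a + s *\<^sub>R v" using Xv[OF \<open>x \<in> X\<close>] by blast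
      then have "fst (\<phi> x) = \<sigma> * s" by (simp add: \<phi>X)
      also have "\<dots> = T x - T a" using hs[of s] s by (simp add: h_def)
      finally show ?thesis by simp
    qed
    then show ?thesis unfolding clock_class_def by blast
  qed
  ultimately show ?thesis unfolding adapted_coordinates_def by blast
qed

end

theory Submission
  imports Defs
begin

text \<open>
  Time translations and rotations about \<open>X\<close> are automorphisms, and together they act transitively
  on the events at a given distance from \<open>X\<close>. Sending an event to its representative on \<open>X\<close> is
  equivariant under them, so the clock reading of the representative of \<open>(t, u)\<close> is \<open>t\<close> minus a
  quantity depending only on \<open>\<parallel>u\<parallel>\<close>, and this quantity is \<open>f\<close>.
\<close>

lemma inertial_coordinates_bij:
  assumes "inertial_coordinates \<phi>"
  shows "bij \<phi>"
proof -
  obtain L p0 where "bij L" and \<phi>: "\<phi> = (\<lambda>p. L (p - p0))"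
    using assms unfolding inertial_coordinates_def by blast
  have "bij (\<lambda>p. p - p0)"
    by (rule bij_betw_byWitness[where f' = "\<lambda>p. p + p0"]) auto
  from bij_comp[OF this \<open>bij L\<close>] show ?thesis
    by (simp add: \<phi> comp_def)
qed

lemma inertial_coordinates_eta:
  assumes "inertial_coordinates \<phi>"
  shows "eta (p - q) (p - q) = (fst (\<phi> p) - fst (\<phi> q))\<^sup>2 - (norm (snd (\<phi> p) - snd (\<phi> q)))\<^sup>2"
proof -
  obtain L p0 where "linear L"
    and eta: "\<And>v w. eta v w = fst (L v) * fst (L w) - snd (L v) \<bullet> snd (L w)"
    and \<phi>: "\<phi> = (\<lambda>p. L (p - p0))"
    using assms unfolding inertial_coordinates_def by blast
  have "L (p - q) = \<phi> p - \<phi> q"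
    unfolding \<phi> by (simp flip: linear_diff[OF \<open>linear L\<close>])
  then show ?thesis
    by (simp add: eta power2_eq_square power2_norm_eq_inner[unfolded power2_eq_square])
qed

text \<open>Supplies the symmetries to which definability is applied: a time shift by
  \<open>s\<close> together with a rotation or reflection \<open>A\<close> of space, conjugated by
  the chart. Time differences and spatial distances are both kept, hence so is the interval.\<close>

lemma adapted_coordinates_automorphism:
  assumes \<phi>: "adapted_coordinates X T \<phi>" and A: "orthogonal_transformation A"
  obtains g where "automorphism X T g"
    and "\<And>p. \<phi> (g p) = (fst (\<phi> p) + s, A (snd (\<phi> p)))"
proof
  have ic: "inertial_coordinates \<phi>" and X: "X = {p. snd (\<phi> p) = 0}"
    using \<phi> by (auto simp: adapted_coordinates_def)
  obtain c where c: "\<And>x. x \<in> X \<Longrightarrow> fst (\<phi> x) = T x + c"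
    using \<phi> unfolding adapted_coordinates_def clock_class_def by blast
  have bij: "bij \<phi>" using ic by (rule inertial_coordinates_bij)
  have lin: "linear A" using A by (rule orthogonal_transformation_linear)
  have bijA: "bij A" using A by (rule orthogonal_transformation_bij)
  define h where "h = (\<lambda>x. (fst x + s, A (snd x)))"
  define g where "g = inv \<phi> \<circ> h \<circ> \<phi>"
  show \<phi>g: "\<phi> (g p) = (fst (\<phi> p) + s, A (snd (\<phi> p)))" for p
    using bij by (simp add: g_def h_def bij_is_surj surj_f_inv_f)
  have A0: "A u = 0 \<longleftrightarrow> u = 0" for u
    using bij_is_inj[OF bijA] linear_0[OF lin] by (metis inj_eq)
  have "bij h"
    by (rule bij_betw_byWitness[where f' = "\<lambda>x. (fst x - s, inv A (snd x))"])
      (use bijA in \<open>auto simp: h_def bij_is_surj surj_f_inv_f bij_is_inj\<close>)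
  then have "bij g"
    unfolding g_def by (intro bij_comp bij bij_imp_bij_inv)
  moreover have gX: "g p \<in> X \<longleftrightarrow> p \<in> X" for p
    by (simp add: X \<phi>g A0)
  then have "g -` X = X"
    by auto
  then have "g ` X = X"
    using surj_image_vimage_eq[OF bij_is_surj[OF \<open>bij g\<close>]] by metis
  moreover have "norm (A u - A v) = norm (u - v)" for u v
    using orthogonal_transformation_norm[OF A] by (simp flip: linear_diff[OF lin])
  then have "causal p q \<longleftrightarrow> causal (g p) (g q)" for p q
    by (simp add: causal_def inertial_coordinates_eta[OF ic] \<phi>g)
  \<comment> \<open>On \<open>X\<close> the clock and the time coordinate differ by the constant
    \<open>c\<close>, which cancels.\<close>
  moreover have "T (g x) - T x = s" if "x \<in> X" for x
    using that c[of x] c[of "g x"] gX by (simp add: \<phi>g)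
  ultimately show "automorphism X T g"
    unfolding automorphism_def by blast
qed

theorem theorem4p1:
  fixes X :: "event set" and T :: "event \<Rightarrow> real" and R :: "event \<Rightarrow> event \<Rightarrow> bool"
  assumes "inertial_observer X"
    and "clock X T"
    and "equivp R"
    and "implicitly_definable X T R"
    and "\<And>y. \<exists>!x. x \<in> X \<and> R x y"
  shows "\<exists>f :: real \<Rightarrow> real. f 0 = 0 \<and> R = Gamma_rel X T f"
proof -
  obtain \<phi> where \<phi>: "adapted_coordinates X T \<phi>"
    using adapted_coordinates_exist assms(1,2) by blast
  then have bij: "bij \<phi>" and X: "X = {p. snd (\<phi> p) = 0}"
    by (auto simp: adapted_coordinates_def inertial_coordinates_bij)
  \<comment> \<open>Each \<open>R\<close>-class meets \<open>X\<close> exactly once. Choosing that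
    event turns \<open>R\<close> into equality of representatives, as \<open>R_iff\<close>
    records.\<close>
  define \<rho> where "\<rho> p = (THE x. x \<in> X \<and> R x p)" for p
  have \<rho>: "\<rho> p \<in> X" "R (\<rho> p) p" for p
    using theI'[OF assms(5)[of p]] by (auto simp: \<rho>_def)
  have \<rho>_eq: "\<rho> p = x" if "x \<in> X" "R x p" for x p
    using that \<rho> assms(5) by blast
  have R_iff: "R p q \<longleftrightarrow> \<rho> p = \<rho> q" for p q
    using \<rho>[of p] \<rho>[of q] \<rho>_eq[of "\<rho> p" q]
    by (metis equivp_symp[OF assms(3)] equivp_transp[OF assms(3)])
  define \<theta> where "\<theta> p = fst (\<phi> p) - fst (\<phi> (\<rho> p))" for p
  have \<theta>_cong: "\<theta> p = \<theta> q" if norm: "norm (snd (\<phi> p)) = norm (snd (\<phi> q))" for p q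
  proof -
    \<comment> \<open>Equal distances from \<open>X\<close> allow an automorphism \<open>g\<close>
      with \<open>g p = q\<close>. It sends the representative of \<open>p\<close> to that of
      \<open>q\<close>, by uniqueness, and shifts both times in \<theta> equally.\<close>
    obtain A where A: "orthogonal_transformation A" "A (snd (\<phi> p)) = snd (\<phi> q)"
      using orthogonal_transformation_exists[OF norm] by blast
    obtain g where g: "automorphism X T g"
      and \<phi>g: "\<And>r. \<phi> (g r) = (fst (\<phi> r) + (fst (\<phi> q) - fst (\<phi> p)), A (snd (\<phi> r)))"
      using adapted_coordinates_automorphism[OF \<phi> A(1)] by blast
    have "\<phi> (g p) = \<phi> q"
      by (simp add: \<phi>g A(2))
    then have "g p = q"
      using bij by (simp add: bij_is_inj inj_eq)
    then have "R (g (\<rho> p)) q"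
      using assms(4) g \<rho>(2)[of p] unfolding implicitly_definable_def by blast
    moreover have "g (\<rho> p) \<in> X"
      using g \<rho>(1) unfolding automorphism_def by blast
    ultimately have "\<rho> q = g (\<rho> p)"
      by (rule \<rho>_eq[rotated])
    then show ?thesis
      by (simp add: \<theta>_def \<phi>g)
  qed
  \<comment> \<open>By \<open>\<theta>_cong\<close> any event at distance \<open>r\<close> from
    \<open>X\<close> would serve as the sample; this one has time 0 and lies on the first spatial
    axis.\<close>
  define f where "f r = \<theta> (inv \<phi> (0, r *\<^sub>R axis 1 1))" for r
  have \<phi>_inv: "\<phi> (inv \<phi> x) = x" for x
    using bij by (simp add: bij_is_surj surj_f_inv_f)
  have f: "f (norm (snd (\<phi> p))) = \<theta> p" for p
    unfolding f_def by (rule \<theta>_cong) (simp add: \<phi>_inv)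
  \<comment> \<open>By reflexivity an event of \<open>X\<close> represents itself.\<close>
  have "\<theta> x = 0" if "x \<in> X" for x
    using \<rho>_eq[OF that] equivp_reflp[OF assms(3)] by (simp add: \<theta>_def)
  then have "f 0 = 0"
    by (simp add: f_def X \<phi>_inv)
  moreover have "R p q \<longleftrightarrow> Gamma_rel X T f p q" for p q
  proof -
    \<comment> \<open>Events of \<open>X\<close> are told apart by their time coordinate. That of
      \<open>\<rho> p\<close> is exactly the \<tau> whose translate of the graph of \<open>f\<close>
      contains \<open>p\<close>.\<close>
    have "\<rho> p = \<rho> q \<longleftrightarrow> fst (\<phi> (\<rho> p)) = fst (\<phi> (\<rho> q))"
      using \<rho>(1)[of p] \<rho>(1)[of q] inj_eq[OF bij_is_inj[OF bij], of "\<rho> p" "\<rho> q"]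
      by (auto simp: X prod_eq_iff)
    then show ?thesis
      unfolding R_iff Gamma_rel_iff[OF \<phi>] by (auto simp: Gamma_def f \<theta>_def)
  qed
  ultimately show ?thesis
    by blast
qed

end
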